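(* A simple quantum graph on the finite quantum set $M_2$ is determined up to isomorphism only by its number of quantum edges $m\in\{0,1,2,3\}$. That is, the number of quantum edges of a simple quantum graph on $M_2$ always lies in $\{0,1,2,3\}$, each of these values is attained, and two simple quantum graphs on $M_2$ are isomorphic if and only if they have the same number of quantum edges.
   Context: The finite quantum set $M_n$ is the C*-algebra $C(M_n)=M_n(\mathbb{C})$ equipped with the functional (counit) $\eta^\dag=n\,\mathrm{Tr}$. The Hilbert space $l^2(M_n)$ is $M_n(\mathbb{C})$ with inner product $\langle a,b\rangle=n\,\mathrm{Tr}(a^*b)$. Let $m$ be the multiplication, $\eta$ the unit map, $\dag$ the adjoint of linear maps with respect to these inner products, $R^\dag=\eta^\dag m$ (so $R^\dag(a\otimes b)=n\,\mathrm{Tr}(ab)$) and $R=m^\dag\eta$. A quantum graph on $M_n$ is an orthogonal projection $\tilde A\in C(M_n)\otimes C(M_n)^{\rm op}$ (the edge projection), where $^{\rm op}$ denotes the opposite algebra. Its adjacency matrix is the linear operator $A=(\mathrm{id}\otimes R^\dag)(\tilde A\otimes\mathrm{id})\colon l^2(M_n)\to l^2(M_n)$. The quantum graph is undirected if $\tilde A$ is invariant under the swap $x\otimes y\mapsto y\otimes x$; it has no loops if $\tilde A\tilde I=0$, where $\tilde I$ is $R$ regarded as an element of $C(M_n)\otimes C(M_n)^{\rm op}$. It is simple if it is undirected and has no loops. Identifying $C(M_n)^{\rm op}$ with $M_n(\mathbb{C})$ by transposition, $\tilde A$ becomes a projection in $M_n(\mathbb{C})\otimes M_n(\mathbb{C})$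 acting on $\mathbb{C}^n\otimes\mathbb{C}^n$; the number of quantum edges is its rank. Two quantum graphs on $M_n$ with adjacency matrices $A$, $B$ are isomorphic if there is a $*$-automorphism $\phi$ of $M_n(\mathbb{C})$ with $\phi\circ A=B\circ\phi$. *)

theory Defs
  imports "HOL-Analysis.Analysis"
begin

type_synonym 'n mat = "complex^'n^'n"

(* The vector space M_n (x) M_n. The tensor with entries t $ (i,k) $ (j,l) is
   the sum of t $ (i,k) $ (j,l) * (e_ij (x) e_kl), so that elementary tensors are
   Kronecker products. The type carries no algebra structure by itself: it is the
   underlying space of l^2(M_n) (x) l^2(M_n), of C(M_n) (x) C(M_n)^op with product
   op_mult below, and of M_n (x) M_n = M_(n^2) with product "**". *)
type_synonym 'n tens = "complex^('n \<times> 'n)^('n \<times> 'n)"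

definition tensor :: "'n::finite mat \<Rightarrow> 'n mat \<Rightarrow> 'n tens" (infixr "\<otimes>\<^sub>K" 75)
  where "a \<otimes>\<^sub>K b = (\<chi> p q. a $ fst p $ fst q * b $ snd p $ snd q)"

definition star :: "complex^'i::finite^'i \<Rightarrow> complex^'i^'i"
  where "star a = map_matrix cnj (transpose a)"


subsection \<open>The finite quantum set $M_n$\<close>

definition counit :: "'n::finite mat \<Rightarrow> complex"
  where "counit a = of_nat CARD('n) * trace a"

definition unit_map :: "complex \<Rightarrow> 'n::finite mat"
  where "unit_map c = mat c"

definition l2_inner :: "'n::finite mat \<Rightarrow> 'n mat \<Rightarrow> complex"
  where "l2_inner a b = of_nat CARD('n) * trace (star a ** b)"

(* The Hilbert tensor product of two copies of l2_inner, see l2_inner_tens_tensor. *)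
definition l2_inner_tens :: "'n::finite tens \<Rightarrow> 'n tens \<Rightarrow> complex"
  where "l2_inner_tens s t = of_nat CARD('n) ^ 2 * trace (star s ** t)"

(* Only used for mult_map, where the adjoint exists and is unique: see
   adjoint_wrt_mult_map. *)
definition adjoint_wrt ::
    "('a \<Rightarrow> 'a \<Rightarrow> complex) \<Rightarrow> ('b \<Rightarrow> 'b \<Rightarrow> complex) \<Rightarrow> ('a \<Rightarrow> 'b) \<Rightarrow> 'b \<Rightarrow> 'a"
  where "adjoint_wrt ip1 ip2 f = (THE g. \<forall>x y. ip2 (f x) y = ip1 x (g y))"

(* The linear map with a (x) b |-> a b. *)
definition mult_map :: "'n::finite tens \<Rightarrow> 'n mat"
  where "mult_map t = (\<chi> i j. \<Sum>k\<in>UNIV. t $ (i, k) $ (k, j))"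

definition R_dag :: "'n::finite tens \<Rightarrow> complex"
  where "R_dag t = counit (mult_map t)"

definition R_map :: "complex \<Rightarrow> 'n::finite tens"
  where "R_map c = adjoint_wrt l2_inner_tens l2_inner mult_map (unit_map c)"


subsection \<open>Quantum graphs on $M_n$\<close>

(* Multiplication of C(M_n) (x) C(M_n)^op: the bilinear map with
   (a (x) b, c (x) d) |-> a c (x) d b, see op_mult_tensor. *)
definition op_mult :: "'n::finite tens \<Rightarrow> 'n tens \<Rightarrow> 'n tens"
  where "op_mult s t = (\<chi> p q. \<Sum>u\<in>UNIV. \<Sum>v\<in>UNIV.
    s $ (fst p, v) $ (u, snd q) * t $ (u, snd p) $ (fst q, v))"

(* The involution of C(M_n) (x) C(M_n)^op is a (x) b |-> a* (x) b*, which is star. *)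
definition quantum_graph :: "'n::finite tens \<Rightarrow> bool"
  where "quantum_graph T \<longleftrightarrow> op_mult T T = T \<and> star T = T"

(* T is the sum over i, j of e_ij (x) b_ij with b_ij $ k $ l = T $ (i,k) $ (j,l),
   so (id (x) R_dag) (T (x) x) is the sum of R_dag (b_ij (x) x) * e_ij. *)
definition adjacency :: "'n::finite tens \<Rightarrow> 'n mat \<Rightarrow> 'n mat"
  where "adjacency T x = (\<chi> i j. R_dag ((\<chi> k l. T $ (i, k) $ (j, l)) \<otimes>\<^sub>K x))"

definition swap_tens :: "'n::finite tens \<Rightarrow> 'n tens"
  where "swap_tens t = (\<chi> p q. t $ (snd p, fst p) $ (snd q, fst q))"

definition undirected :: "'n::finite tens \<Rightarrow> bool"
  where "undirected T \<longleftrightarrow> swap_tens T = T"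

definition no_loops :: "'n::finite tens \<Rightarrow> bool"
  where "no_loops T \<longleftrightarrow> op_mult T (R_map 1) = 0"

definition simple_quantum_graph :: "'n::finite tens \<Rightarrow> bool"
  where "simple_quantum_graph T \<longleftrightarrow> quantum_graph T \<and> undirected T \<and> no_loops T"

(* The *-isomorphism id (x) transposition from C(M_n) (x) C(M_n)^op
   to M_n (x) M_n = M_(n^2). *)
definition transpose_op :: "'n::finite tens \<Rightarrow> 'n tens"
  where "transpose_op t = (\<chi> p q. t $ (fst p, snd q) $ (fst q, snd p))"

definition num_edges :: "'n::finite tens \<Rightarrow> nat"
  where "num_edges T = rank (transpose_op T)"

definition star_automorphism :: "('n::finite mat \<Rightarrow> 'n mat) \<Rightarrow> bool"
  where "star_automorphism \<phi> \<longleftrightarrow> bij \<phi>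
    \<and> (\<forall>a b. \<phi> (a + b) = \<phi> a + \<phi> b)
    \<and> (\<forall>c a. \<phi> (map_matrix ((*) c) a) = map_matrix ((*) c) (\<phi> a))
    \<and> (\<forall>a b. \<phi> (a ** b) = \<phi> a ** \<phi> b)
    \<and> (\<forall>a. \<phi> (star a) = star (\<phi> a))"

definition isomorphic_qg :: "'n::finite tens \<Rightarrow> 'n tens \<Rightarrow> bool"
  where "isomorphic_qg S T \<longleftrightarrow>
    (\<exists>\<phi>. star_automorphism \<phi> \<and> \<phi> \<circ> adjacency S = adjacency T \<circ> \<phi>)"


subsection \<open>The coordinate formulas on elementary tensors\<close>

lemma tensor_nth: "(a \<otimes>\<^sub>K b) $ (i, k) $ (j, l) = a $ i $ j * b $ k $ l"
  by (simp add: tensor_def)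

lemma star_tensor: "star (a \<otimes>\<^sub>K b) = star a \<otimes>\<^sub>K star b"
  by (simp add: vec_eq_iff star_def transpose_def tensor_def)

lemma mult_map_tensor: "mult_map (a \<otimes>\<^sub>K b) = a ** b"
  by (simp add: vec_eq_iff mult_map_def tensor_def matrix_matrix_mult_def)

lemma R_dag_tensor: "R_dag ((a :: 'n::finite mat) \<otimes>\<^sub>K b) = of_nat CARD('n) * trace (a ** b)"
  by (simp add: R_dag_def mult_map_tensor counit_def)

lemma op_mult_tensor: "op_mult (a \<otimes>\<^sub>K b) (c \<otimes>\<^sub>K d) = (a ** c) \<otimes>\<^sub>K (d ** b)"
proof -
  have "(\<Sum>u\<in>UNIV. \<Sum>v\<in>UNIV. a $ i $ u * b $ v $ l * (c $ u $ j * d $ k $ v))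
      = (\<Sum>u\<in>UNIV. a $ i $ u * c $ u $ j) * (\<Sum>v\<in>UNIV. d $ k $ v * b $ v $ l)" for i j k l
    unfolding sum_product by (intro sum.cong refl) (simp add: mult_ac)
  then show ?thesis
    by (simp add: vec_eq_iff op_mult_def tensor_def matrix_matrix_mult_def)
qed

lemma swap_tens_tensor: "swap_tens (a \<otimes>\<^sub>K b) = b \<otimes>\<^sub>K a"
  by (simp add: vec_eq_iff swap_tens_def tensor_def)

lemma adjacency_tensor:
  "adjacency (a \<otimes>\<^sub>K b) x = map_matrix ((*) (R_dag (b \<otimes>\<^sub>K x))) a"
  by (simp add: vec_eq_iff adjacency_def R_dag_def counit_def mult_map_def trace_def
      tensor_def sum_distrib_left mult_ac)

lemma transpose_op_tensor: "transpose_op (a \<otimes>\<^sub>K b) = a \<otimes>\<^sub>K transpose b"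
  by (simp add: vec_eq_iff transpose_op_def tensor_def transpose_def)

lemma sum_UNIV_prod:
  "(\<Sum>p\<in>UNIV. f p) = (\<Sum>i\<in>UNIV. \<Sum>k\<in>UNIV. f (i :: 'a::finite, k :: 'b::finite))"
  by (simp add: sum.cartesian_product flip: UNIV_Times_UNIV)

lemma transpose_op_op_mult: "transpose_op (op_mult s t) = transpose_op s ** transpose_op t"
  by (simp add: vec_eq_iff transpose_op_def op_mult_def matrix_matrix_mult_def sum_UNIV_prod)

lemma transpose_op_star: "transpose_op (star t) = star (transpose_op t)"
  by (simp add: vec_eq_iff transpose_op_def star_def transpose_def)

lemma tensor_matrix_mult: "(a \<otimes>\<^sub>K b) ** (c \<otimes>\<^sub>K d) = (a ** c) \<otimes>\<^sub>K (b ** d)"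
proof -
  have "(\<Sum>u\<in>UNIV. \<Sum>v\<in>UNIV. a $ i $ u * b $ k $ v * (c $ u $ j * d $ v $ l))
      = (\<Sum>u\<in>UNIV. a $ i $ u * c $ u $ j) * (\<Sum>v\<in>UNIV. b $ k $ v * d $ v $ l)" for i j k l
    unfolding sum_product by (intro sum.cong refl) (simp add: mult_ac)
  then show ?thesis
    by (simp add: vec_eq_iff matrix_matrix_mult_def tensor_def sum_UNIV_prod)
qed

lemma trace_tensor: "trace (a \<otimes>\<^sub>K b) = trace a * trace b"
  by (simp add: trace_def tensor_nth sum_UNIV_prod sum_product)

lemma l2_inner_tens_tensor:
  "l2_inner_tens (a \<otimes>\<^sub>K b) (c \<otimes>\<^sub>K d) = l2_inner a c * l2_inner b d"
  by (simp add: l2_inner_tens_def l2_inner_def star_tensor tensor_matrix_mult trace_tensor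
      power2_eq_square)

lemma l2_inner_eq:
  "l2_inner (a :: 'n::finite mat) b =
    of_nat CARD('n) * (\<Sum>i\<in>UNIV. \<Sum>j\<in>UNIV. cnj (a $ j $ i) * b $ j $ i)"
  by (simp add: l2_inner_def trace_def matrix_matrix_mult_def star_def transpose_def)

lemma l2_inner_tens_eq:
  "l2_inner_tens (s :: 'n::finite tens) t =
    of_nat CARD('n) ^ 2 * (\<Sum>p\<in>UNIV. \<Sum>q\<in>UNIV. cnj (s $ q $ p) * t $ q $ p)"
  by (simp add: l2_inner_tens_def trace_def matrix_matrix_mult_def star_def transpose_def)

lemma counit_eq_adjoint_unit_map: "cnj c * counit a = l2_inner (unit_map c) a"
proof -
  have "(\<Sum>j\<in>UNIV. cnj (unit_map c $ j $ i) * a $ j $ i) = cnj c * a $ i $ i" for i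
    by (simp add: unit_map_def mat_def if_distrib [of cnj] if_distrib [of "\<lambda>x. x * _"] cong: if_cong)
  then show ?thesis
    by (simp add: counit_def l2_inner_eq trace_def sum_distrib_left mult_ac)
qed

lemma adjoint_wrt_mult_map:
  "adjoint_wrt l2_inner_tens l2_inner mult_map (y :: 'n::finite mat) =
    (\<chi> p q. if snd p = fst q then y $ fst p $ snd q / of_nat CARD('n) else 0)"
proof -
  define G :: "'n mat \<Rightarrow> 'n tens" where
    "G = (\<lambda>y. \<chi> p q. if snd p = fst q then y $ fst p $ snd q / of_nat CARD('n) else 0)"
  have G: "l2_inner (mult_map x) y = l2_inner_tens x (G y)" for x y
  proof -
    have "(\<Sum>p\<in>UNIV. \<Sum>q\<in>UNIV. cnj (x $ q $ p) * G y $ q $ p)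
        = (\<Sum>k\<in>UNIV. \<Sum>j\<in>UNIV. \<Sum>i\<in>UNIV. cnj (x $ (i, k) $ (k, j)) * (y $ i $ j / of_nat CARD('n)))"
      by (simp add: sum_UNIV_prod G_def if_distrib [of "\<lambda>x. _ * x"] cong: if_cong)
    also have "\<dots> = (\<Sum>j\<in>UNIV. \<Sum>i\<in>UNIV. \<Sum>k\<in>UNIV. cnj (x $ (i, k) $ (k, j)) * (y $ i $ j / of_nat CARD('n)))"
      by (subst sum.swap, rule sum.cong [OF refl], rule sum.swap)
    also have "\<dots> = (\<Sum>j\<in>UNIV. \<Sum>i\<in>UNIV. cnj (mult_map x $ i $ j) * y $ i $ j) / of_nat CARD('n)"
      by (simp add: mult_map_def sum_divide_distrib sum_distrib_right)
    finally show ?thesis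
      unfolding l2_inner_eq l2_inner_tens_eq by (simp add: power2_eq_square)
  qed
  have inj: "s = t" if "\<And>x. l2_inner_tens x s = l2_inner_tens x t" for s t :: "'n tens"
  proof -
    have "s $ a $ b = t $ a $ b" for a b
    proof -
      have *: "l2_inner_tens (\<chi> p q. if p = a then if q = b then 1 else 0 else 0) u
          = of_nat CARD('n) ^ 2 * u $ a $ b" for u :: "'n tens"
        by (simp add: l2_inner_tens_eq if_distrib [of cnj] if_distrib [of "\<lambda>x. x * _"] cong: if_cong)
      show ?thesis
        using that [of "\<chi> p q. if p = a then if q = b then 1 else 0 else 0"] by (simp add: *)
    qed
    then show ?thesis by (simp add: vec_eq_iff)
  qed
  have "adjoint_wrt l2_inner_tens l2_inner mult_map = G"
    unfolding adjoint_wrt_def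
  proof (rule the_equality)
    show "\<forall>x y. l2_inner (mult_map x) y = l2_inner_tens x (G y)" using G by blast
    show "g = G" if "\<forall>x y. l2_inner (mult_map x) y = l2_inner_tens x (g y)" for g
      using that G by (metis inj ext)
  qed
  then show ?thesis by (simp add: G_def)
qed

(* The value at 1 is (1/n) times the sum over i, j of e_ij (x) e_ji. *)
lemma R_map_1:
  "(R_map 1 :: 'n::finite tens) =
    (\<chi> p q. if fst p = snd q \<and> snd p = fst q then 1 / of_nat CARD('n) else 0)"
  by (auto simp: vec_eq_iff R_map_def adjoint_wrt_mult_map unit_map_def mat_def)

lemma quantum_graph_R_map_1: "quantum_graph (R_map 1 :: 'n::finite tens)"
proof -
  have "op_mult (R_map 1) (R_map 1) $ (i, k) $ (j, l) = (R_map 1 :: 'n tens) $ (i, k) $ (j, l)"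
    for i k j l
    by (simp add: op_mult_def R_map_1 if_distrib [of "\<lambda>x. x * _"] cong: if_cong conj_cong)
  then show ?thesis
    by (auto simp: quantum_graph_def vec_eq_iff star_def transpose_def R_map_1)
qed

end

theory Submission
  imports Defs
begin

text \<open>
  Read a vector of $\mathbb{C}^2 \otimes \mathbb{C}^2$ with components $X_{il}$ as the matrix
  $X \in M_2$. Then \<open>transpose_op T\<close> is an orthogonal projection of $M_2$ onto a subspace $V$, and the
  number of edges is $\dim V$. The loop tensor \<open>R_map 1\<close> becomes the projection onto the multiples
  of the identity matrix, so the absence of loops says that $V$ consists of traceless matrices.
  Invariance under the swap, combined with self-adjointness, says that $V$ is closed under the
  adjoint. Hence $V$ is the complexification of a real space of traceless Hermitian matrices, and
  the Pauli matrices identify the traceless Hermitian matrices with $\mathbb{R}^3$. Simple quantum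
  graphs on $M_2$ are therefore the same as real symmetric idempotents $q$ of size three
  (\<open>simple_spin_graph\<close>, \<open>simple_imp_spin_graph\<close>), and the number of edges is the trace of $q$.

  Such a $q$ is 0, 1, the projection onto a line or the projection onto a plane
  (\<open>symmetric_idempotent3_cases\<close>), which gives the four possible numbers of edges. For isomorphism
  of graphs with equally many edges it remains to rotate one line onto another, because a plane is
  the complement of its normal line. If $\sigma(v) = \sum_a v_a \sigma_a$, then the graph of the line
  through the unit vector $v$ has adjacency matrix $x \mapsto \sigma(v)\, x\, \sigma(v)$, and conjugation
  by $\sigma(a)$ is the half turn about the axis $a$. The half turn about the bisector of $v$ and $w$
  exchanges these two vectors (\<open>star_automorphism_moving_spin\<close>).

  Conversely an isomorphism preserves the number of edges, on $M_n$ for every $n$: the rank of an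
  idempotent is its trace, this trace can be read off from the trace of the adjacency matrix
  applied to the unit, and automorphisms preserve both the unit and the trace
  (\<open>isomorphic_imp_num_edges_eq\<close>).
\<close>

section \<open>Matrix algebra\<close>

lemma matrix_mult_add_rdistrib: "(a + b) ** c = a ** c + b ** c"
  for a b :: "'a::semiring_1^'n^'m"
  by (simp add: vec_eq_iff matrix_matrix_mult_def distrib_right sum.distrib)

lemma matrix_mult_diff_ldistrib: "a ** (b - c) = a ** b - a ** c"
  for a :: "'a::ring_1^'n^'m"
  by (simp add: vec_eq_iff matrix_matrix_mult_def right_diff_distrib sum_subtractf)

lemma matrix_mult_diff_rdistrib: "(a - b) ** c = a ** c - b ** c"
  for a b :: "'a::ring_1^'n^'m"
  by (simp add: vec_eq_iff matrix_matrix_mult_def left_diff_distrib sum_subtractf)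

lemma mat_mult_eq_scale: "mat c ** x = map_matrix ((*) c) x"
  for x :: "'n::finite mat"
  by (simp add: vec_eq_iff mat_def matrix_matrix_mult_def if_distrib[of "\<lambda>x. x * _"]
      cong: if_cong)

lemma map_matrix_of_real_mult:
  "map_matrix of_real (q ** q') = map_matrix of_real q ** (map_matrix of_real q' :: complex^'n^'n)"
  by (simp add: vec_eq_iff matrix_matrix_mult_def)

text \<open>Let $B$ be a basis of the row space, and let $r_i(b)$ be the coefficient of $b$ in row $i$. The
  idempotent fixes every $b \in B$ under multiplication from the right; comparing the coefficients
  of $b$ in this identity gives $\sum_i b_i r_i(b) = 1$, and the trace is the sum of these
  expressions over $b \in B$.\<close>

lemma idempotent_rank_eq_trace:
  fixes A :: "'a::field^'n^'n"
  assumes "A ** A = A"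
  shows "of_nat (rank A) = trace A"
proof -
  obtain B where B: "B \<subseteq> rows A" "vec.independent B" "rows A \<subseteq> vec.span B"
      "card B = vec.dim (rows A)"
    using vec.basis_exists by blast
  have "finite B"
    using B(2) vec.finiteI_independent by blast
  define r where "r i = vec.representation B (A $ i)" for i
  have row: "A $ i = (\<Sum>b\<in>B. r i b *s b)" for i
  proof -
    have "A $ i \<in> vec.span B"
      using B(3) by (auto simp: rows_def row_def)
    then show ?thesis
      using vec.sum_representation_eq[OF B(2), of "A $ i" B] \<open>finite B\<close> by (simp add: r_def)
  qed
  have fixed: "(\<Sum>i\<in>UNIV. b $ i *s A $ i) = b" if b: "b \<in> B" for b
  proof -
    obtain k where "b = A $ k"
      using subsetD[OF B(1) b] by (auto simp: rows_def row_def)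
    have "(\<Sum>i\<in>UNIV. A $ k $ i *s A $ i) = (A ** A) $ k"
      by (simp add: vec_eq_iff matrix_matrix_mult_def)
    then show ?thesis
      by (simp add: assms \<open>b = A $ k\<close>)
  qed
  have delta: "(\<Sum>i\<in>UNIV. b $ i * r i b) = 1" if "b \<in> B" for b
  proof -
    have "(\<Sum>i\<in>UNIV. b $ i * r i b) = vec.representation B (\<Sum>i\<in>UNIV. b $ i *s A $ i) b"
    proof -
      have sp: "A $ i \<in> vec.span B" for i
        using B(3) by (auto simp: rows_def row_def)
      then show ?thesis
        by (simp add: vec.representation_sum[OF B(2)] vec.span_scale
            vec.representation_scale[OF B(2)] r_def)
    qed
    also have "\<dots> = 1"
      by (simp add: fixed[OF that] vec.representation_basis[OF B(2) that])
    finally show ?thesis .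
  qed
  have "trace A = (\<Sum>i\<in>UNIV. \<Sum>b\<in>B. r i b * b $ i)"
    unfolding trace_def by (subst row) (simp)
  also have "\<dots> = (\<Sum>b\<in>B. \<Sum>i\<in>UNIV. b $ i * r i b)"
    by (subst sum.swap) (simp add: mult.commute)
  also have "\<dots> = of_nat (card B)"
    by (simp add: delta)
  finally show ?thesis
    by (simp add: B(4) row_rank_def_gen)
qed

section \<open>Symmetric idempotents of three-dimensional space\<close>

definition proj_matrix :: "real^'n::finite \<Rightarrow> real^'n^'n"
  where "proj_matrix v = (\<chi> i j. v $ i * v $ j)"

lemma proj_matrix_mult_vector: "proj_matrix v *v x = (v \<bullet> x) *\<^sub>R v"
  by (simp add: vec_eq_iff proj_matrix_def matrix_vector_mult_def inner_vec_def
      sum_distrib_left mult_ac)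

lemma transpose_proj_matrix: "transpose (proj_matrix v) = proj_matrix v"
  by (simp add: vec_eq_iff proj_matrix_def transpose_def)

lemma proj_matrix_idempotent:
  assumes "norm v = 1"
  shows "proj_matrix v ** proj_matrix v = proj_matrix v"
  using assms by (simp add: matrix_eq proj_matrix_mult_vector norm_eq_1 flip: matrix_vector_mul_assoc)

lemma trace_proj_matrix: "norm v = 1 \<Longrightarrow> trace (proj_matrix v) = 1"
  by (simp add: trace_def proj_matrix_def norm_eq_1 inner_vec_def)

lemma symmetric_matrix_inner:
  fixes q :: "real^'n^'n"
  assumes "transpose q = q"
  shows "(q *v x) \<bullet> y = x \<bullet> (q *v y)"
  using assms by (metis dot_lmul_matrix transpose_matrix_vector)

text \<open>By Lagrange's formula for the double cross product, a vector orthogonal to $v$ and $u$ has zero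
  cross product with $v \times u$, hence is parallel to it.\<close>

lemma orthogonal_cross_unit:
  fixes v u x :: "real^3"
  assumes "norm v = 1" "norm u = 1" "v \<bullet> u = 0" "x \<bullet> v = 0" "x \<bullet> u = 0"
  shows "x = (x \<bullet> cross3 v u) *\<^sub>R cross3 v u"
proof -
  define w where "w = cross3 v u"
  have "(norm w)\<^sup>2 = 1"
    using norm_cross_dot[of v u] assms by (simp add: w_def)
  then have w: "w \<bullet> w = 1"
    by (simp add: power2_norm_eq_inner)
  have "cross3 w x = 0"
    using Lagrange[of x v u] assms cross_skew[of w x] by (simp add: w_def)
  have "x = (x \<bullet> w) *\<^sub>R w"
  proof (rule cross_dot_cancel[of w])
    show "w \<noteq> 0" using w by auto
  qed (simp_all add: \<open>cross3 w x = 0\<close> w cross_mult_right inner_commute)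
  then show ?thesis by (simp add: w_def)
qed

lemma orthonormal_expansion3:
  fixes v u x :: "real^3"
  assumes "norm v = 1" "norm u = 1" "v \<bullet> u = 0"
  shows "x = (x \<bullet> v) *\<^sub>R v + (x \<bullet> u) *\<^sub>R u + (x \<bullet> cross3 v u) *\<^sub>R cross3 v u"
proof -
  define y where "y = x - (x \<bullet> v) *\<^sub>R v - (x \<bullet> u) *\<^sub>R u"
  have "v \<bullet> v = 1" "u \<bullet> u = 1"
    using assms by (simp_all add: norm_eq_1)
  then have "y \<bullet> v = 0" "y \<bullet> u = 0" "y \<bullet> cross3 v u = x \<bullet> cross3 v u"
    using assms(3) inner_commute[of u v] by (simp_all add: y_def inner_diff_left dot_cross_self)
  then show ?thesis
    using orthogonal_cross_unit[OF assms, of y] by (simp add: y_def algebra_simps)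
qed

text \<open>Apart from the two trivial cases there are a unit vector $v$ in the range and a unit vector $u$ in
  the kernel. They are orthogonal by symmetry, and $v \times u$ is then an eigenvector too. Its
  eigenvalue is 0 or 1, so that the range is the line of $v$ or the kernel is the line of $u$.\<close>

lemma symmetric_idempotent3_cases:
  fixes q :: "real^3^3"
  assumes sym: "transpose q = q" and idem: "q ** q = q"
  obtains "q = 0" | "q = mat 1"
    | v where "norm v = 1" "q = proj_matrix v"
    | v where "norm v = 1" "q = mat 1 - proj_matrix v"
proof (cases "q = 0 \<or> q = mat 1")
  case False
  have qq: "q *v (q *v x) = q *v x" for x
    by (simp add: matrix_vector_mul_assoc idem)
  obtain x where "q *v x \<noteq> 0"
    using False by (metis matrix_eq matrix_vector_mult_0)
  define v where "v = (1 / norm (q *v x)) *\<^sub>R (q *v x)"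
  have v: "norm v = 1" "q *v v = v"
    using \<open>q *v x \<noteq> 0\<close> by (simp_all add: v_def matrix_vector_mult_scaleR qq)
  obtain y where y: "y - q *v y \<noteq> 0"
    using False by (metis matrix_eq matrix_vector_mul_lid eq_iff_diff_eq_0)
  define u where "u = (1 / norm (y - q *v y)) *\<^sub>R (y - q *v y)"
  have u: "norm u = 1" "q *v u = 0"
    using y by (simp_all add: u_def matrix_vector_mult_scaleR matrix_vector_mult_diff_distrib qq)
  have vu: "v \<bullet> u = 0"
    using symmetric_matrix_inner[OF sym, of v u] by (simp add: v u)
  define w where "w = cross3 v u"
  have "(norm w)\<^sup>2 = 1"
    using norm_cross_dot[of v u] v u vu by (simp add: w_def)
  then have ww: "w \<bullet> w = 1" "w \<noteq> 0"
    by (auto simp: power2_norm_eq_inner)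
  have "(q *v w) \<bullet> v = 0" "(q *v w) \<bullet> u = 0"
    by (simp_all add: symmetric_matrix_inner[OF sym] v u w_def dot_cross_self)
  then obtain c where c: "q *v w = c *\<^sub>R w"
    using orthogonal_cross_unit[OF v(1) u(1) vu] w_def by blast
  have exp: "x = (x \<bullet> v) *\<^sub>R v + (x \<bullet> u) *\<^sub>R u + (x \<bullet> w) *\<^sub>R w" for x
    unfolding w_def by (rule orthonormal_expansion3[OF v(1) u(1) vu])
  have q: "q *v x = (x \<bullet> v) *\<^sub>R v + ((x \<bullet> w) * c) *\<^sub>R w" for x
    by (subst exp[of x]) (simp add: matrix_vector_right_distrib matrix_vector_mult_scaleR v u c)
  have "c *\<^sub>R c *\<^sub>R w = c *\<^sub>R w"
    using qq[of w] by (simp add: c matrix_vector_mult_scaleR)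
  then have "c = 0 \<or> c = 1"
    using ww by simp
  then show thesis
  proof
    assume "c = 0"
    then have "q = proj_matrix v"
      by (simp add: matrix_eq q proj_matrix_mult_vector inner_commute)
    then show thesis using that(3) v by blast
  next
    assume "c = 1"
    have "q *v x = (mat 1 - proj_matrix u) *v x" for x
      using exp[of x] q[of x] \<open>c = 1\<close>
      by (simp add: matrix_vector_mult_diff_rdistrib proj_matrix_mult_vector inner_commute
          algebra_simps)
    then have "q = mat 1 - proj_matrix u"
      by (simp add: matrix_eq)
    then show thesis using that(4) u by blast
  qed
qed (use that in blast)

section \<open>Automorphisms of the matrix algebra\<close>

definition matrix_unit :: "'n::finite \<Rightarrow> 'n \<Rightarrow> 'n mat"
  where "matrix_unit i j = (\<chi> k l. if k = i \<and> l = j then 1 else 0)"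

lemma matrix_unit_mult:
  "matrix_unit i j ** matrix_unit k l = (if j = k then matrix_unit i l else 0)"
  by (auto simp: vec_eq_iff matrix_unit_def matrix_matrix_mult_def
      if_distrib[of "\<lambda>x. x * _"] cong: if_cong conj_cong)

lemma matrix_unit_sum:
  "(\<Sum>i\<in>UNIV. \<Sum>j\<in>UNIV. map_matrix ((*) (a $ i $ j)) (matrix_unit i j)) = a"
proof -
  have "(\<Sum>i\<in>UNIV. \<Sum>j\<in>UNIV. a $ i $ j * (if k = i \<and> l = j then 1 else 0))
      = (\<Sum>i\<in>UNIV. if k = i then (\<Sum>j\<in>UNIV. if l = j then a $ i $ j else 0) else 0)" for k l
    by (intro sum.cong refl) (auto simp: if_distrib[of "\<lambda>x. _ * x"] cong: if_cong)
  then show ?thesis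
    by (simp add: vec_eq_iff matrix_unit_def if_distrib[of "\<lambda>x. _ * x"] cong: if_cong)
qed

lemma trace_scale: "trace (map_matrix ((*) c) a) = c * trace a"
  for a :: "'n::finite mat"
  by (simp add: trace_def sum_distrib_left)

lemma trace_sum: "trace (sum f I) = (\<Sum>i\<in>I. trace (f i :: 'n::finite mat))"
  by (simp add: trace_def sum.swap[of _ I])

context
  fixes \<phi> :: "'n::finite mat \<Rightarrow> 'n mat"
  assumes \<phi>: "star_automorphism \<phi>"
begin

lemma star_automorphism_add: "\<phi> (a + b) = \<phi> a + \<phi> b"
  and star_automorphism_scale: "\<phi> (map_matrix ((*) c) a) = map_matrix ((*) c) (\<phi> a)"
  and star_automorphism_mult: "\<phi> (a ** b) = \<phi> a ** \<phi> b"
  using \<phi> by (simp_all add: star_automorphism_def)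

lemma star_automorphism_0: "\<phi> 0 = 0"
  using star_automorphism_add[of 0 0] by simp

lemma star_automorphism_diff: "\<phi> (a - b) = \<phi> a - \<phi> b"
  using star_automorphism_add[of "a - b" b] by simp

lemma star_automorphism_sum: "\<phi> (sum f I) = (\<Sum>i\<in>I. \<phi> (f i))"
  using sum_comp_morphism[of \<phi> f I] star_automorphism_0 star_automorphism_add
  by (simp add: comp_def)

lemma star_automorphism_1: "\<phi> (mat 1) = mat 1"
proof -
  obtain b where b: "\<phi> b = mat 1"
    using \<phi> unfolding star_automorphism_def by (metis bij_pointE)
  then show ?thesis
    using star_automorphism_mult[of "mat 1" b] by simp
qed

text \<open>The functional $a \mapsto \mathrm{Tr}(\phi(a))$ is invariant under cyclic permutation of products.
  Evaluated on matrix units, this determines it up to a factor, which the unit shows to be 1.\<close>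

lemma trace_star_automorphism: "trace (\<phi> a) = trace a"
proof -
  have cyc: "trace (\<phi> (a ** b)) = trace (\<phi> (b ** a))" for a b
    unfolding star_automorphism_mult by (rule trace_mul_sym)
  have off: "trace (\<phi> (matrix_unit i j)) = 0" if "i \<noteq> j" for i j
    using cyc[of "matrix_unit i i" "matrix_unit i j"] that
    by (simp add: matrix_unit_mult star_automorphism_0 trace_0[unfolded mat_0])
  have diag: "trace (\<phi> (matrix_unit i i)) = trace (\<phi> (matrix_unit j j))" for i j
    using cyc[of "matrix_unit i j" "matrix_unit j i"] by (simp add: matrix_unit_mult)
  obtain k :: 'n where True by blast
  define t where "t = trace (\<phi> (matrix_unit k k))"
  have unit: "trace (\<phi> (matrix_unit i j)) = (if i = j then t else 0)" for i j
    using off diag t_def by auto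
  have tr: "trace (\<phi> a) = t * trace a" for a
  proof -
    have "trace (\<phi> a) = (\<Sum>i\<in>UNIV. \<Sum>j\<in>UNIV. a $ i $ j * (if i = j then t else 0))"
      by (subst matrix_unit_sum[of a, symmetric])
        (simp add: star_automorphism_sum star_automorphism_scale trace_sum trace_scale unit)
    also have "\<dots> = t * trace a"
      by (simp add: trace_def if_distrib sum_distrib_left mult.commute cong: if_cong)
    finally show ?thesis .
  qed
  have "t = 1"
    using tr[of "mat 1"] by (simp add: star_automorphism_1 trace_I)
  then show ?thesis
    by (simp add: tr)
qed

end

lemma star_automorphism_ident: "star_automorphism (\<lambda>x. x)"
  by (simp add: star_automorphism_def bij_def)

lemma star_mult: "star (a ** b) = star b ** star a"
  by (simp add: vec_eq_iff star_def transpose_def matrix_matrix_mult_def mult.commute)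

lemma star_star: "star (star a) = a"
  by (simp add: vec_eq_iff star_def transpose_def)

lemma map_matrix_scale_mult:
  "map_matrix ((*) c) (a ** b) = map_matrix ((*) c) a ** b"
  "map_matrix ((*) c) (a ** b) = a ** map_matrix ((*) c) b"
  for a b :: "'n::finite mat"
  by (simp_all add: vec_eq_iff matrix_matrix_mult_def sum_distrib_left mult_ac)

lemma star_automorphism_conjugation:
  fixes u :: "'n::finite mat"
  assumes "star u ** u = mat 1" "u ** star u = mat 1"
  shows "star_automorphism (\<lambda>x. u ** x ** star u)"
proof -
  have l: "star u ** (u ** a) = a" "u ** (star u ** a) = a" for a
    by (simp_all add: matrix_mul_assoc assms)
  have "bij (\<lambda>x. u ** x ** star u)"
    by (rule o_bij[of "\<lambda>x. star u ** x ** u"])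
      (simp_all add: fun_eq_iff matrix_mul_assoc[symmetric] l assms)
  then show ?thesis
    by (simp add: star_automorphism_def matrix_mul_assoc[symmetric] l star_mult star_star
        map_matrix_scale_mult[symmetric] matrix_add_ldistrib
        matrix_mult_add_rdistrib)
qed

section \<open>The number of edges is an isomorphism invariant\<close>

lemma transpose_op_0: "transpose_op 0 = 0"
  by (simp add: vec_eq_iff transpose_op_def)

lemma transpose_op_transpose_op: "transpose_op (transpose_op T) = T"
  by (simp add: vec_eq_iff transpose_op_def)

lemma adjacency_eq:
  "adjacency T x $ i $ j =
    of_nat CARD('n) * (\<Sum>k\<in>UNIV. \<Sum>l\<in>UNIV. T $ (i, k) $ (j, l) * x $ l $ k)"
  for x :: "'n::finite mat"
  by (simp add: adjacency_def R_dag_def counit_def mult_map_tensor trace_def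
      matrix_matrix_mult_def)

lemma adjacency_diff: "adjacency (S - T) x = adjacency S x - adjacency T x"
  by (simp add: vec_eq_iff adjacency_eq left_diff_distrib sum_subtractf right_diff_distrib)

lemma trace_adjacency_1: "trace (adjacency T (mat 1)) = of_nat CARD('n) * trace T"
  for T :: "'n::finite tens"
  by (simp add: trace_def adjacency_eq mat_def sum_UNIV_prod sum_distrib_left
      if_distrib[of "\<lambda>x. _ * x"] cong: if_cong)

lemma trace_transpose_op: "trace (transpose_op T) = trace T"
  by (simp add: trace_def transpose_op_def)

lemma num_edges_eq_trace:
  assumes "quantum_graph T"
  shows "of_nat (num_edges T) = trace T"
proof -
  have "transpose_op T ** transpose_op T = transpose_op T"
    using assms by (simp add: quantum_graph_def flip: transpose_op_op_mult)
  then show ?thesis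
    unfolding num_edges_def by (simp add: idempotent_rank_eq_trace trace_transpose_op)
qed

text \<open>The quantity $\mathrm{Tr}(A(1)) = n\,\mathrm{Tr}(T)$ depends only on the adjacency matrix $A$ up to
  conjugation by an automorphism, and it is $n$ times the number of edges.\<close>

lemma isomorphic_imp_num_edges_eq:
  fixes S T :: "'n::finite tens"
  assumes "quantum_graph S" "quantum_graph T" "isomorphic_qg S T"
  shows "num_edges S = num_edges T"
proof -
  obtain \<phi> where \<phi>: "star_automorphism \<phi>" "\<phi> \<circ> adjacency S = adjacency T \<circ> \<phi>"
    using assms(3) by (auto simp: isomorphic_qg_def)
  have "\<phi> (adjacency S (mat 1)) = adjacency T (mat 1)"
    using \<phi>(2) star_automorphism_1[OF \<phi>(1)] by (metis comp_apply)
  then have "trace (adjacency S (mat 1)) = trace (adjacency T (mat 1))"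
    using trace_star_automorphism[OF \<phi>(1)] by metis
  then have "trace S = trace T"
    by (simp add: trace_adjacency_1)
  then show ?thesis
    using assms(1,2) by (metis num_edges_eq_trace of_nat_eq_iff)
qed

section \<open>Pauli coordinates for simple quantum graphs\<close>

definition pauli :: "3 \<Rightarrow> 2 mat"
  where "pauli a = (\<chi> i j.
    if a = 1 then if i = j then 0 else 1
    else if a = 2 then if i = j then 0 else if i = 1 then -\<i> else \<i>
    else if i \<noteq> j then 0 else if i = 1 then 1 else -1)"

lemma pauli_nth:
  "pauli 1 $ 1 $ 1 = 0" "pauli 1 $ 1 $ 2 = 1" "pauli 1 $ 2 $ 1 = 1" "pauli 1 $ 2 $ 2 = 0"
  "pauli 2 $ 1 $ 1 = 0" "pauli 2 $ 1 $ 2 = -\<i>" "pauli 2 $ 2 $ 1 = \<i>" "pauli 2 $ 2 $ 2 = 0"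
  "pauli 3 $ 1 $ 1 = 1" "pauli 3 $ 1 $ 2 = 0" "pauli 3 $ 2 $ 1 = 0" "pauli 3 $ 2 $ 2 = -1"
  by (simp_all add: pauli_def)

lemma cnj_pauli: "cnj (pauli a $ i $ j) = pauli a $ j $ i"
  using exhaust_2[of i] exhaust_2[of j] exhaust_3[of a] by (auto simp: pauli_nth)

text \<open>A matrix $X$ is treated as a vector indexed by the pairs \<open>(i, l)\<close>. Synthesis maps coefficients
  $c$ to $\sum_a c_a \sigma_a$. Analysis maps $X$ to the coefficients $\frac12 \mathrm{Tr}(\sigma_a X)$;
  since the $\sigma_a$ are Hermitian, it is half the adjoint of synthesis.\<close>

definition pauli_synthesis :: "complex^3^(2 \<times> 2)"
  where "pauli_synthesis = (\<chi> p a. pauli a $ fst p $ snd p)"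

definition pauli_analysis :: "complex^(2 \<times> 2)^3"
  where "pauli_analysis = (\<chi> a p. pauli a $ snd p $ fst p / 2)"

lemma pauli_analysis_synthesis: "pauli_analysis ** pauli_synthesis = mat 1"
  by (simp add: vec_eq_iff matrix_matrix_mult_def pauli_analysis_def pauli_synthesis_def
      sum_UNIV_prod sum_2 forall_3 pauli_nth mat_def)

text \<open>The Pauli matrices and the identity form an orthogonal basis of $M_2$, so this composition is the
  orthogonal projection onto the traceless matrices.\<close>

lemma pauli_synthesis_analysis:
  "pauli_synthesis ** pauli_analysis = mat 1 - transpose_op (R_map 1)"
  by (simp add: vec_eq_iff matrix_matrix_mult_def pauli_analysis_def pauli_synthesis_def
      sum_3 forall_2 split_paired_all pauli_nth mat_def transpose_op_def R_map_1)

text \<open>The projection $q$ of coefficient vectors, transported to a projection of $M_2$ that annihilates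
  the identity matrix, and turned into an edge projection by the inverse of \<open>transpose_op\<close>, which
  is \<open>transpose_op\<close> itself.\<close>

definition spin_graph :: "real^3^3 \<Rightarrow> 2 tens"
  where "spin_graph q =
    transpose_op (pauli_synthesis ** map_matrix of_real q ** pauli_analysis)"

lemma spin_graph_nth:
  "spin_graph q $ (i, k) $ (j, l) =
    (\<Sum>a\<in>UNIV. \<Sum>b\<in>UNIV. of_real (q $ a $ b) * pauli a $ i $ l * pauli b $ k $ j) / 2"
proof -
  have "spin_graph q $ (i, k) $ (j, l) =
    (\<Sum>b\<in>UNIV. \<Sum>a\<in>UNIV. of_real (q $ a $ b) * pauli a $ i $ l * pauli b $ k $ j / 2)"
    by (simp add: spin_graph_def transpose_op_def matrix_matrix_mult_def pauli_synthesis_def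
        pauli_analysis_def sum_distrib_right sum_distrib_left sum_divide_distrib mult_ac)
  then show ?thesis
    by (subst sum.swap) (simp add: sum_divide_distrib)
qed

lemma spin_graph_diff: "spin_graph (p - q) = spin_graph p - spin_graph q"
  by (simp add: vec_eq_iff spin_graph_nth sum_subtractf algebra_simps diff_divide_distrib)

lemma trace_spin_graph: "trace (spin_graph q) = of_real (trace q)"
proof -
  have "trace (spin_graph q) = trace ((pauli_synthesis ** map_matrix of_real q) ** pauli_analysis)"
    by (simp add: spin_graph_def trace_transpose_op)
  also have "\<dots> = trace (pauli_analysis ** (pauli_synthesis ** map_matrix of_real q))"
    by (rule trace_mul_sym)
  also have "\<dots> = of_real (trace q)"
    by (simp add: matrix_mul_assoc pauli_analysis_synthesis) (simp add: trace_def)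
  finally show ?thesis .
qed

text \<open>The three conditions on the edge projection come from those on $q$: analysis is a left inverse of
  synthesis, which gives idempotency; both self-adjointness and swap-invariance reduce to the symmetry
  of $q$, because the $\sigma_a$ are Hermitian; and the $\sigma_a$ are traceless, which excludes loops.\<close>

lemma simple_spin_graph:
  assumes "transpose q = q" "q ** q = q"
  shows "simple_quantum_graph (spin_graph q)"
proof -
  let ?B = pauli_synthesis and ?C = pauli_analysis
  let ?Q = "map_matrix of_real q :: complex^3^3"
  let ?R = "transpose_op (R_map 1) :: 2 tens"
  have sym: "q $ a $ b = q $ b $ a" for a b
    using arg_cong[OF assms(1), of "\<lambda>m. m $ b $ a"] by (simp add: transpose_def)
  have CB: "?C ** (?B ** X) = X" for X :: "complex^'k^3"
    by (simp add: matrix_mul_assoc pauli_analysis_synthesis)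
  have QQ: "?Q ** (?Q ** X) = ?Q ** X" for X :: "complex^'k^3"
    using assms(2) map_matrix_of_real_mult[of q q] by (simp add: matrix_mul_assoc)
  have "transpose_op (op_mult (spin_graph q) (spin_graph q)) = transpose_op (spin_graph q)"
    by (simp add: transpose_op_op_mult spin_graph_def transpose_op_transpose_op CB QQ
        flip: matrix_mul_assoc)
  then have idem: "op_mult (spin_graph q) (spin_graph q) = spin_graph q"
    by (metis transpose_op_transpose_op)
  have flip: "(\<Sum>a\<in>UNIV. \<Sum>b\<in>UNIV. of_real (q $ a $ b) * pauli a $ k $ j * pauli b $ i $ l)
      = (\<Sum>a\<in>UNIV. \<Sum>b\<in>UNIV. of_real (q $ a $ b) * pauli a $ i $ l * pauli b $ k $ j)"
    for i j k l
  proof (subst sum.swap, intro sum.cong refl)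
    show "of_real (q $ b $ a) * pauli b $ k $ j * pauli a $ i $ l
        = of_real (q $ a $ b) * pauli a $ i $ l * pauli b $ k $ j" for a b
      using sym[of a b] by simp
  qed
  have star: "star (spin_graph q) = spin_graph q"
    by (simp add: vec_eq_iff star_def transpose_def spin_graph_nth cnj_pauli flip)
  have swap: "swap_tens (spin_graph q) = spin_graph q"
    by (simp add: vec_eq_iff swap_tens_def spin_graph_nth flip)
  have "?C = ?C - ?C ** ?R"
  proof -
    have "?C ** (?B ** ?C) = ?C ** (mat 1 - ?R)"
      by (simp only: pauli_synthesis_analysis)
    then show ?thesis
      by (simp add: CB matrix_mult_diff_ldistrib)
  qed
  then have CR: "?C ** ?R = 0"
    by simp
  have "transpose_op (op_mult (spin_graph q) (R_map 1)) = 0"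
    by (simp add: transpose_op_op_mult spin_graph_def transpose_op_transpose_op CR
        flip: matrix_mul_assoc)
  then have "op_mult (spin_graph q) (R_map 1) = 0"
    by (metis transpose_op_transpose_op transpose_op_0)
  then show ?thesis
    using idem star swap
    by (simp add: simple_quantum_graph_def quantum_graph_def undirected_def no_loops_def)
qed

text \<open>The matrix $Q$ of the projection in Pauli coordinates recovers it completely, because a loopless
  projection vanishes on the identity matrix. Swap-invariance makes $Q$ symmetric and
  self-adjointness makes it Hermitian, so its entries are real.\<close>

lemma simple_imp_spin_graph:
  assumes "simple_quantum_graph T"
  obtains q where "transpose q = q" "q ** q = q" "T = spin_graph q"
proof -
  let ?B = pauli_synthesis and ?C = pauli_analysis
  let ?R = "transpose_op (R_map 1) :: 2 tens"
  define P where "P = transpose_op T"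
  have T: "op_mult T T = T" "star T = T" "swap_tens T = T" "op_mult T (R_map 1) = 0"
    using assms
    by (simp_all add: simple_quantum_graph_def quantum_graph_def undirected_def no_loops_def)
  have PP: "P ** P = P" and sP: "star P = P" and PR: "P ** ?R = 0"
    using T by (simp_all add: P_def transpose_op_0
        flip: transpose_op_op_mult transpose_op_star)
  have sR: "star ?R = ?R"
    using quantum_graph_R_map_1 unfolding quantum_graph_def by (metis transpose_op_star)
  have RP: "?R ** P = 0"
  proof -
    have "star (?R ** P) = 0"
      by (simp add: star_mult sR sP PR)
    then have "star (star (?R ** P)) = star 0"
      by simp
    then show ?thesis
      by (simp add: star_star) (simp add: vec_eq_iff star_def transpose_def)
  qed
  have PBC: "P ** (?B ** ?C) = P"
    by (simp add: pauli_synthesis_analysis matrix_mult_diff_ldistrib PR)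
  have BCP: "(?B ** ?C) ** P = P"
    by (simp add: pauli_synthesis_analysis matrix_mult_diff_rdistrib RP)
  define Q where "Q = ?C ** P ** ?B"
  have QQ: "Q ** Q = Q"
  proof -
    have "Q ** Q = ?C ** (P ** (?B ** ?C) ** P) ** ?B"
      by (simp add: Q_def matrix_mul_assoc)
    also have "\<dots> = ?C ** (P ** P) ** ?B"
      by (simp only: PBC)
    finally show ?thesis
      by (simp add: PP Q_def)
  qed
  have BQC: "?B ** Q ** ?C = P"
  proof -
    have "?B ** Q ** ?C = (?B ** ?C) ** P ** (?B ** ?C)"
      by (simp add: Q_def matrix_mul_assoc)
    then show ?thesis
      by (simp add: BCP PBC)
  qed
  have Q: "Q $ a $ b = (\<Sum>j\<in>UNIV. \<Sum>k\<in>UNIV. \<Sum>i\<in>UNIV. \<Sum>l\<in>UNIV.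
      pauli a $ l $ i * T $ (i, k) $ (j, l) * pauli b $ j $ k) / 2" for a b
    by (simp add: Q_def P_def matrix_matrix_mult_def pauli_synthesis_def pauli_analysis_def
        transpose_op_def sum_UNIV_prod sum_distrib_right sum_distrib_left sum_divide_distrib mult_ac)
  have swap: "T $ (i, k) $ (j, l) = T $ (k, i) $ (l, j)" for i j k l
    by (subst T(3)[symmetric]) (simp add: swap_tens_def)
  have herm: "T $ (i, k) $ (j, l) = cnj (T $ (j, l) $ (i, k))" for i j k l
    by (subst T(2)[symmetric]) (simp add: star_def transpose_def)
  have sym: "Q $ a $ b = Q $ b $ a" for a b
  proof -
    \<comment> \<open>Reversing the order of summation exchanges the roles of the two tensor legs.\<close>
    have rev: "(\<Sum>j\<in>UNIV. \<Sum>k\<in>UNIV. \<Sum>i\<in>UNIV. \<Sum>l\<in>UNIV. f j k i l)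
        = (\<Sum>l\<in>UNIV. \<Sum>i\<in>UNIV. \<Sum>k\<in>UNIV. \<Sum>j\<in>UNIV. f j k i l)"
      for f :: "2 \<Rightarrow> 2 \<Rightarrow> 2 \<Rightarrow> 2 \<Rightarrow> complex"
      by (simp add: sum_2 algebra_simps)
    have summand: "pauli a $ l $ i * T $ (i, k) $ (j, l) * pauli b $ j $ k
        = pauli b $ j $ k * T $ (k, i) $ (l, j) * pauli a $ l $ i" for i j k l
      using swap[of i k j l] by simp
    show ?thesis
      unfolding Q by (subst rev) (simp only: summand)
  qed
  have "cnj (Q $ a $ b) = Q $ b $ a" for a b
  proof -
    have swp: "(\<Sum>j\<in>UNIV. \<Sum>k\<in>UNIV. \<Sum>i\<in>UNIV. \<Sum>l\<in>UNIV. f j k i l)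
        = (\<Sum>i\<in>UNIV. \<Sum>l\<in>UNIV. \<Sum>j\<in>UNIV. \<Sum>k\<in>UNIV. f j k i l)"
      for f :: "2 \<Rightarrow> 2 \<Rightarrow> 2 \<Rightarrow> 2 \<Rightarrow> complex"
      by (simp add: sum_2 algebra_simps)
    have summand: "cnj (pauli a $ l $ i * T $ (i, k) $ (j, l) * pauli b $ j $ k)
        = pauli b $ k $ j * T $ (j, l) $ (i, k) * pauli a $ i $ l" for i j k l
      using herm[of j l i k] by (simp add: cnj_pauli)
    show ?thesis
      unfolding Q complex_cnj_divide cnj_sum summand by (subst swp) simp
  qed
  then have real: "of_real (Re (Q $ a $ b)) = Q $ a $ b" for a b
    using sym by (metis Reals_cnj_iff of_real_Re)
  define q where "q = map_matrix Re Q"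
  have q: "map_matrix of_real q = Q"
    by (simp add: q_def vec_eq_iff real)
  show thesis
  proof (rule that)
    show "transpose q = q"
      using sym by (simp add: q_def vec_eq_iff transpose_def)
    have "map_matrix of_real (q ** q) = (map_matrix of_real q :: complex^3^3)"
      by (simp add: map_matrix_of_real_mult q QQ)
    then show "q ** q = q"
      by (simp add: vec_eq_iff)
    show "T = spin_graph q"
      using BQC by (simp add: spin_graph_def q P_def transpose_op_transpose_op)
  qed
qed

lemma num_edges_spin_graph:
  assumes "transpose q = q" "q ** q = q"
  shows "real (num_edges (spin_graph q)) = trace q"
proof -
  have "of_nat (num_edges (spin_graph q)) = (of_real (trace q) :: complex)"
    using simple_spin_graph[OF assms] num_edges_eq_trace[of "spin_graph q"]
    by (simp add: simple_quantum_graph_def trace_spin_graph)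
  then show ?thesis
    by (metis of_real_eq_iff of_real_of_nat_eq)
qed

lemma num_edges_cases:
  assumes q: "transpose q = q" "q ** q = q"
  obtains "num_edges (spin_graph q) = 0" "q = 0"
    | v where "num_edges (spin_graph q) = 1" "norm v = 1" "q = proj_matrix v"
    | v where "num_edges (spin_graph q) = 2" "norm v = 1" "q = mat 1 - proj_matrix v"
    | "num_edges (spin_graph q) = 3" "q = mat 1"
proof -
  note num = num_edges_spin_graph[OF q]
  from q show thesis
  proof (cases rule: symmetric_idempotent3_cases)
    case 1
    then have "num_edges (spin_graph q) = 0"
      using num by (simp add: trace_def)
    then show thesis using 1 that(1) by blast
  next
    case 2
    then have "num_edges (spin_graph q) = 3"
      using num by (simp add: trace_I)
    then show thesis using 2 that(4) by blast
  next
    case (3 v)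
    then have "num_edges (spin_graph q) = 1"
      using num by (simp add: trace_proj_matrix)
    then show thesis using 3 that(2) by blast
  next
    case (4 v)
    then have "num_edges (spin_graph q) = 2"
      using num by (simp add: trace_proj_matrix trace_sub trace_I)
    then show thesis using 4 that(3) by blast
  qed
qed

section \<open>Rotating one spin matrix into another\<close>

text \<open>The traceless Hermitian matrix with Pauli coordinates $v$. For unit vectors it is also unitary,
  and so it serves both as a Kraus operator of a graph and as the unitary of an automorphism.\<close>

definition spin :: "real^3 \<Rightarrow> 2 mat"
  where "spin v = (\<chi> i j. \<Sum>a\<in>UNIV. of_real (v $ a) * pauli a $ i $ j)"

lemma star_spin: "star (spin v) = spin v"
  by (simp add: vec_eq_iff spin_def star_def transpose_def cnj_pauli)

lemma spin_anticommute: "spin v ** spin w + spin w ** spin v = mat (of_real (2 * (v \<bullet> w)))"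
  by (simp add: vec_eq_iff spin_def matrix_matrix_mult_def mat_def forall_2 sum_2 sum_3
      pauli_nth inner_vec_def algebra_simps)

lemma spin_square:
  assumes "norm v = 1"
  shows "spin v ** spin v = mat 1"
proof -
  have "2 * (spin v ** spin v) $ i $ j = 2 * mat 1 $ i $ j" for i j
    using arg_cong[OF spin_anticommute[of v v], of "\<lambda>m. m $ i $ j"] assms
    by (simp add: norm_eq_1 mat_def)
  then show ?thesis
    by (simp add: vec_eq_iff)
qed

text \<open>Conjugation by \<open>spin a\<close> fixes the component of $v$ along $a$ and negates the orthogonal one: it
  is the half turn about the axis $a$.\<close>

lemma spin_reflection:
  assumes "norm a = 1"
  shows "spin a ** spin v ** spin a = spin ((2 * (a \<bullet> v)) *\<^sub>R a - v)"
proof -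
  have "spin a ** spin v = mat (of_real (2 * (a \<bullet> v))) - spin v ** spin a"
    using spin_anticommute[of a v] by (simp add: algebra_simps)
  then have "spin a ** spin v ** spin a = mat (of_real (2 * (a \<bullet> v))) ** spin a - spin v"
    by (simp add: matrix_mult_diff_rdistrib spin_square[OF assms] flip: matrix_mul_assoc)
  also have "\<dots> = spin ((2 * (a \<bullet> v)) *\<^sub>R a - v)"
    by (simp add: mat_mult_eq_scale vec_eq_iff spin_def sum_distrib_left sum_subtractf
        algebra_simps)
  finally show ?thesis .
qed

lemma adjacency_spin_graph_proj:
  "adjacency (spin_graph (proj_matrix v)) x = spin v ** x ** spin v"
proof -
  have nth: "spin_graph (proj_matrix v) $ (i, k) $ (j, l) = spin v $ i $ l * spin v $ k $ j / 2"
    for i j k l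
    by (simp add: spin_graph_nth proj_matrix_def spin_def sum_product mult_ac)
  show ?thesis
    by (simp add: vec_eq_iff adjacency_eq nth matrix_matrix_mult_def sum_distrib_right
        sum_distrib_left mult_ac)
qed

lemma adjacency_spin_graph_1: "adjacency (spin_graph (mat 1)) x = mat (2 * trace x) - x"
proof -
  have "map_matrix of_real (mat 1) = (mat 1 :: complex^3^3)"
    by (simp add: vec_eq_iff mat_def)
  then have "spin_graph (mat 1) = transpose_op (mat 1 - transpose_op (R_map 1))"
    by (simp add: spin_graph_def pauli_synthesis_analysis)
  then have nth: "spin_graph (mat 1) $ (i, k) $ (j, l) =
      (if i = j \<and> l = k then 1 else 0) - (if i = l \<and> k = j then 1 / 2 else 0)" for i j k l
    by (simp add: transpose_op_def R_map_1 mat_def)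
  show ?thesis
    by (simp add: vec_eq_iff adjacency_eq nth forall_2 sum_2) (simp add: mat_def trace_def sum_2)
qed

text \<open>The graph with all three edges is invariant under every automorphism, because its adjacency matrix
  is built from the trace and the unit. Subtracting from it reduces two edges to one.\<close>

lemma star_automorphism_adjacency_1:
  assumes "star_automorphism \<phi>"
  shows "\<phi> (adjacency (spin_graph (mat 1)) x) = adjacency (spin_graph (mat 1)) (\<phi> x)"
proof -
  have "mat c = map_matrix ((*) c) (mat 1)" for c :: complex
    by (simp add: vec_eq_iff mat_def)
  then have "\<phi> (mat c) = mat c" for c
    by (metis star_automorphism_1[OF assms] star_automorphism_scale[OF assms])
  then show ?thesis
    by (simp add: adjacency_spin_graph_1 star_automorphism_diff[OF assms]
        trace_star_automorphism[OF assms])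
qed

lemma star_automorphism_moving_spin:
  assumes "norm v = 1" "norm w = 1"
  obtains \<phi> where "star_automorphism \<phi>"
    "\<And>x. \<phi> (adjacency (spin_graph (proj_matrix v)) x)
        = adjacency (spin_graph (proj_matrix w)) (\<phi> x)"
proof (cases "v + w = 0")
  case True
  \<comment> \<open>Opposite vectors have no bisector, but they span the same line.\<close>
  then have "proj_matrix w = proj_matrix v"
    by (simp add: eq_neg_iff_add_eq_0[symmetric] proj_matrix_def)
  then show ?thesis
    using that[OF star_automorphism_ident] by simp
next
  case False
  \<comment> \<open>The axis of the half turn that exchanges $v$ and $w$.\<close>
  define a where "a = (1 / norm (v + w)) *\<^sub>R (v + w)"
  have a: "norm a = 1"
    using False by (simp add: a_def)
  have "(norm (v + w))\<^sup>2 = 2 * ((v + w) \<bullet> v)"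
    using assms
    by (simp add: power2_norm_eq_inner inner_add_left inner_add_right norm_eq_1 inner_commute)
  then have "2 * (a \<bullet> v) = norm (v + w)"
    using False by (simp add: a_def power2_eq_square divide_simps)
  then have "(2 * (a \<bullet> v)) *\<^sub>R a = v + w"
    using False by (simp add: a_def)
  then have move: "spin a ** spin v ** spin a = spin w"
    by (simp add: spin_reflection[OF a])
  note sq = spin_square[OF a]
  define \<phi> where "\<phi> = (\<lambda>x. spin a ** x ** spin a)"
  have sq': "spin a ** (spin a ** x) = x" for x
    by (simp add: matrix_mul_assoc sq)
  have "star_automorphism \<phi>"
    using star_automorphism_conjugation[of "spin a"] by (simp add: \<phi>_def star_spin sq)
  moreover have "\<phi> (spin v ** x ** spin v) = spin w ** \<phi> x ** spin w" for x
    by (simp add: \<phi>_def sq' flip: move matrix_mul_assoc)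
  ultimately show ?thesis
    using that by (simp add: adjacency_spin_graph_proj)
qed

text \<open>Equal numbers of edges put both idempotents in the same case of the classification, where the
  automorphism for two lines also serves for their orthogonal planes.\<close>

lemma num_edges_eq_imp_isomorphic:
  assumes p: "transpose p = p" "p ** p = p"
    and q: "transpose q = q" "q ** q = q"
    and eq: "num_edges (spin_graph p) = num_edges (spin_graph q)"
  shows "isomorphic_qg (spin_graph p) (spin_graph q)"
proof -
  consider "p = q"
    | v w where "norm v = 1" "norm w = 1" "p = proj_matrix v" "q = proj_matrix w"
    | v w where "norm v = 1" "norm w = 1" "p = mat 1 - proj_matrix v" "q = mat 1 - proj_matrix w"
    by (rule num_edges_cases[OF p]; rule num_edges_cases[OF q]; use eq in force)
  then show ?thesis
  proof cases
    case 1
    then show ?thesis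
      using star_automorphism_ident by (auto simp: isomorphic_qg_def fun_eq_iff)
  next
    case (2 v w)
    then show ?thesis
      using star_automorphism_moving_spin[of v w]
      by (metis isomorphic_qg_def comp_apply ext)
  next
    case (3 v w)
    obtain \<phi> where \<phi>: "star_automorphism \<phi>"
      "\<And>x. \<phi> (adjacency (spin_graph (proj_matrix v)) x)
        = adjacency (spin_graph (proj_matrix w)) (\<phi> x)"
      using star_automorphism_moving_spin[OF 3(1,2)] by blast
    have "\<phi> (adjacency (spin_graph p) x) = adjacency (spin_graph q) (\<phi> x)" for x
      by (simp add: 3 spin_graph_diff adjacency_diff star_automorphism_diff[OF \<phi>(1)] \<phi>(2)
          star_automorphism_adjacency_1[OF \<phi>(1)])
    then show ?thesis
      using \<phi>(1) by (auto simp: isomorphic_qg_def fun_eq_iff)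
  qed
qed

section \<open>Classification\<close>

theorem theorem3p11:
  shows "(\<forall>T :: 2 tens. simple_quantum_graph T \<longrightarrow> num_edges T \<in> {0, 1, 2, 3})
    \<and> (\<forall>m \<in> {0, 1, 2, 3}. \<exists>T :: 2 tens. simple_quantum_graph T \<and> num_edges T = m)
    \<and> (\<forall>S T :: 2 tens. simple_quantum_graph S \<longrightarrow> simple_quantum_graph T \<longrightarrow>
         (isomorphic_qg S T \<longleftrightarrow> num_edges S = num_edges T))"
proof (intro conjI allI impI ballI)
  fix T :: "2 tens"
  assume "simple_quantum_graph T"
  then obtain q where "transpose q = q" "q ** q = q" "T = spin_graph q"
    by (rule simple_imp_spin_graph)
  then show "num_edges T \<in> {0, 1, 2, 3}"
    by (cases rule: num_edges_cases) auto
next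
  fix m :: nat
  assume "m \<in> {0, 1, 2, 3}"
  define e :: "real^3" where "e = axis 1 1"
  have e: "norm e = 1"
    by (simp add: e_def)
  have "\<exists>q :: real^3^3. transpose q = q \<and> q ** q = q \<and> trace q = real m"
  proof -
    consider "m = 0" | "m = 1" | "m = 2" | "m = 3"
      using \<open>m \<in> {0, 1, 2, 3}\<close> by auto
    then show ?thesis
    proof cases
      case 1
      then show ?thesis
        by (intro exI[of _ 0]) (simp add: vec_eq_iff transpose_def trace_def)
    next
      case 2
      then show ?thesis
        by (intro exI[of _ "proj_matrix e"])
          (simp add: transpose_proj_matrix proj_matrix_idempotent trace_proj_matrix e)
    next
      case 3
      have "transpose (mat 1 - proj_matrix e) = mat 1 - proj_matrix e"
        by (simp add: vec_eq_iff transpose_def mat_def proj_matrix_def mult.commute)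
      with 3 show ?thesis
        by (intro exI[of _ "mat 1 - proj_matrix e"])
          (simp add: matrix_mult_diff_ldistrib matrix_mult_diff_rdistrib proj_matrix_idempotent
            trace_proj_matrix e trace_sub trace_I)
    next
      case 4
      then show ?thesis
        by (intro exI[of _ "mat 1"]) (simp add: trace_I)
    qed
  qed
  then obtain q :: "real^3^3" where "transpose q = q" "q ** q = q" "trace q = real m"
    by blast
  then show "\<exists>T :: 2 tens. simple_quantum_graph T \<and> num_edges T = m"
    using simple_spin_graph num_edges_spin_graph by (metis of_nat_eq_iff)
next
  fix S T :: "2 tens"
  assume S: "simple_quantum_graph S" and T: "simple_quantum_graph T"
  show "isomorphic_qg S T \<longleftrightarrow> num_edges S = num_edges T"
  proof
    show "num_edges S = num_edges T" if "isomorphic_qg S T"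
      using isomorphic_imp_num_edges_eq[OF _ _ that] S T by (simp add: simple_quantum_graph_def)
  next
    assume eq: "num_edges S = num_edges T"
    obtain p where p: "transpose p = p" "p ** p = p" "S = spin_graph p"
      using S by (rule simple_imp_spin_graph)
    obtain q where q: "transpose q = q" "q ** q = q" "T = spin_graph q"
      using T by (rule simple_imp_spin_graph)
    show "isomorphic_qg S T"
      using num_edges_eq_imp_isomorphic[OF p(1,2) q(1,2)] eq by (simp add: p(3) q(3))
  qed
qed

end
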